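(* Let $R$ be a commutative ring with identity. Every algebraic diagonal pair $(A,B)$ over $R$ is an algebraic Cartan pair.
   Context: Let $A$ be an $R$-algebra and $B\subseteq A$ a commutative subalgebra. $I(B)$ is the set of idempotents of $B$; it is a set of local units for $A$ if every finite $\{a_1,\dots,a_n\}\subseteq A$ admits $e\in I(B)$ with $ea_i=a_i=a_ie$ for all $i$. In that case $N(B)=\{n\in A:\exists k\in A,\ knk=k,\ nkn=n,\ kBn\cup nBk\subseteq B\}$; $k$ is unique, denoted $n^\dagger$. A normaliser $n\in N(B)$ is free if $n\in B$ or $(n^\dagger n)(nn^\dagger)=0$. A conditional expectation $P\colon A\to B$ is an $R$-linear map with $P|_B=\mathrm{id}_B$ and $P(bab')=bP(a)b'$ for $a\in A$, $b,b'\in B$; it is faithful if for each $a\in A\setminus\{0\}$ there is $n\in N(B)$ with $P(na)\neq0$. Suppose that: if $t\in R$ and $e\in I(B)\setminus\{0\}$ satisfy $te=0$, then $t=0$; (i) $I(B)$ is a set of local units for $A$; (ii) $B=\operatorname{span}_RI(B)$; (iii) $A=\operatorname{span}_RN(B)$; (iv) there is a faithful conditional expectation $A\to B$. Then $(A,B)$ is an algebraic diagonal pair if $A$ is spanned (over $R$) by the free normalisers of $B$, and an algebraic Cartan pair if $B$ is a maximal commutative subalgebra of $A$. *)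

theory Defs
  imports "HOL-Algebra.Module"
begin

text \<open>
  Associative algebras over a commutative ring \<open>R\<close>, not assumed to be unital or commutative.
  Since \<open>module\<close> records extend \<open>ring\<close> records, \<open>A\<close> also has a field \<open>one\<close>; it is
  unconstrained and never used. The ring \<open>R\<close> itself is unital and may be trivial.
\<close>

locale assoc_algebra = module R A for R (structure) and A (structure) +
  assumes mult_closed:
      "\<lbrakk>x \<in> carrier A; y \<in> carrier A\<rbrakk> \<Longrightarrow> x \<otimes>\<^bsub>A\<^esub> y \<in> carrier A"
    and mult_assoc:
      "\<lbrakk>x \<in> carrier A; y \<in> carrier A; z \<in> carrier A\<rbrakk> \<Longrightarrow>
        (x \<otimes>\<^bsub>A\<^esub> y) \<otimes>\<^bsub>A\<^esub> z = x \<otimes>\<^bsub>A\<^esub> (y \<otimes>\<^bsub>A\<^esub> z)"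
    and mult_l_distr:
      "\<lbrakk>x \<in> carrier A; y \<in> carrier A; z \<in> carrier A\<rbrakk> \<Longrightarrow>
        (x \<oplus>\<^bsub>A\<^esub> y) \<otimes>\<^bsub>A\<^esub> z = x \<otimes>\<^bsub>A\<^esub> z \<oplus>\<^bsub>A\<^esub> y \<otimes>\<^bsub>A\<^esub> z"
    and mult_r_distr:
      "\<lbrakk>x \<in> carrier A; y \<in> carrier A; z \<in> carrier A\<rbrakk> \<Longrightarrow>
        z \<otimes>\<^bsub>A\<^esub> (x \<oplus>\<^bsub>A\<^esub> y) = z \<otimes>\<^bsub>A\<^esub> x \<oplus>\<^bsub>A\<^esub> z \<otimes>\<^bsub>A\<^esub> y"
    and smult_mult_l:
      "\<lbrakk>t \<in> carrier R; x \<in> carrier A; y \<in> carrier A\<rbrakk> \<Longrightarrow>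
        (t \<odot>\<^bsub>A\<^esub> x) \<otimes>\<^bsub>A\<^esub> y = t \<odot>\<^bsub>A\<^esub> (x \<otimes>\<^bsub>A\<^esub> y)"
    and smult_mult_r:
      "\<lbrakk>t \<in> carrier R; x \<in> carrier A; y \<in> carrier A\<rbrakk> \<Longrightarrow>
        x \<otimes>\<^bsub>A\<^esub> (t \<odot>\<^bsub>A\<^esub> y) = t \<odot>\<^bsub>A\<^esub> (x \<otimes>\<^bsub>A\<^esub> y)"
begin

definition lin_span :: "'c set \<Rightarrow> 'c set" where
  "lin_span S =
    {\<Oplus>\<^bsub>A\<^esub>x\<in>F. c x \<odot>\<^bsub>A\<^esub> x | F c. finite F \<and> F \<subseteq> S \<and> c \<in> F \<rightarrow> carrier R}"

definition comm_subalgebra :: "'c set \<Rightarrow> bool" where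
  "comm_subalgebra B \<longleftrightarrow>
    submodule B R A \<and> (\<forall>x\<in>B. \<forall>y\<in>B. x \<otimes>\<^bsub>A\<^esub> y \<in> B \<and> x \<otimes>\<^bsub>A\<^esub> y = y \<otimes>\<^bsub>A\<^esub> x)"

definition maximal_comm_subalgebra :: "'c set \<Rightarrow> bool" where
  "maximal_comm_subalgebra B \<longleftrightarrow>
    comm_subalgebra B \<and> (\<forall>C. comm_subalgebra C \<and> B \<subseteq> C \<longrightarrow> C = B)"

definition idempotents :: "'c set \<Rightarrow> 'c set" where
  "idempotents B = {e \<in> B. e \<otimes>\<^bsub>A\<^esub> e = e}"

definition local_units :: "'c set \<Rightarrow> bool" where
  "local_units E \<longleftrightarrow>
    (\<forall>F. finite F \<and> F \<subseteq> carrier A \<longrightarrow> (\<exists>e\<in>E. \<forall>a\<in>F. e \<otimes>\<^bsub>A\<^esub> a = a \<and> a \<otimes>\<^bsub>A\<^esub> e = a))"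

definition is_dagger :: "'c set \<Rightarrow> 'c \<Rightarrow> 'c \<Rightarrow> bool" where
  "is_dagger B n k \<longleftrightarrow>
    k \<in> carrier A \<and> k \<otimes>\<^bsub>A\<^esub> n \<otimes>\<^bsub>A\<^esub> k = k \<and> n \<otimes>\<^bsub>A\<^esub> k \<otimes>\<^bsub>A\<^esub> n = n \<and>
    (\<forall>b\<in>B. k \<otimes>\<^bsub>A\<^esub> b \<otimes>\<^bsub>A\<^esub> n \<in> B \<and> n \<otimes>\<^bsub>A\<^esub> b \<otimes>\<^bsub>A\<^esub> k \<in> B)"

definition normalisers :: "'c set \<Rightarrow> 'c set" where
  "normalisers B = {n \<in> carrier A. \<exists>k. is_dagger B n k}"

text \<open>Well defined on normalisers by \<open>is_dagger_unique\<close> below.\<close>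

definition dagger :: "'c set \<Rightarrow> 'c \<Rightarrow> 'c" where
  "dagger B n = (THE k. is_dagger B n k)"

definition free_normalisers :: "'c set \<Rightarrow> 'c set" where
  "free_normalisers B =
    {n \<in> normalisers B. n \<in> B \<or>
      (dagger B n \<otimes>\<^bsub>A\<^esub> n) \<otimes>\<^bsub>A\<^esub> (n \<otimes>\<^bsub>A\<^esub> dagger B n) = \<zero>\<^bsub>A\<^esub>}"

definition conditional_expectation :: "'c set \<Rightarrow> ('c \<Rightarrow> 'c) \<Rightarrow> bool" where
  "conditional_expectation B P \<longleftrightarrow>
    P \<in> carrier A \<rightarrow> B \<and>
    (\<forall>x\<in>carrier A. \<forall>y\<in>carrier A. P (x \<oplus>\<^bsub>A\<^esub> y) = P x \<oplus>\<^bsub>A\<^esub> P y) \<and>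
    (\<forall>t\<in>carrier R. \<forall>x\<in>carrier A. P (t \<odot>\<^bsub>A\<^esub> x) = t \<odot>\<^bsub>A\<^esub> P x) \<and>
    (\<forall>b\<in>B. P b = b) \<and>
    (\<forall>a\<in>carrier A. \<forall>b\<in>B. \<forall>b'\<in>B. P (b \<otimes>\<^bsub>A\<^esub> a \<otimes>\<^bsub>A\<^esub> b') = b \<otimes>\<^bsub>A\<^esub> P a \<otimes>\<^bsub>A\<^esub> b')"

definition faithful_expectation :: "'c set \<Rightarrow> ('c \<Rightarrow> 'c) \<Rightarrow> bool" where
  "faithful_expectation B P \<longleftrightarrow>
    (\<forall>a\<in>carrier A - {\<zero>\<^bsub>A\<^esub>}. \<exists>n\<in>normalisers B. P (n \<otimes>\<^bsub>A\<^esub> a) \<noteq> \<zero>\<^bsub>A\<^esub>)"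

lemma is_dagger_unique:
  assumes B: "comm_subalgebra B" and lu: "local_units (idempotents B)"
    and n: "n \<in> carrier A" and k: "is_dagger B n k" and l: "is_dagger B n l"
  shows "k = l"
proof -
  note [simp] = mult_closed mult_assoc
  have kl: "k \<in> carrier A" "l \<in> carrier A"
    and e1: "k \<otimes>\<^bsub>A\<^esub> (n \<otimes>\<^bsub>A\<^esub> k) = k" "n \<otimes>\<^bsub>A\<^esub> (k \<otimes>\<^bsub>A\<^esub> n) = n"
    and e2: "l \<otimes>\<^bsub>A\<^esub> (n \<otimes>\<^bsub>A\<^esub> l) = l" "n \<otimes>\<^bsub>A\<^esub> (l \<otimes>\<^bsub>A\<^esub> n) = n"
    using k l n by (auto simp: is_dagger_def)
  have prods: "n \<otimes>\<^bsub>A\<^esub> m \<in> B \<and> m \<otimes>\<^bsub>A\<^esub> n \<in> B" if m: "is_dagger B n m" for m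
  proof -
    have mA: "m \<in> carrier A" using m by (simp add: is_dagger_def)
    obtain e where e: "e \<in> idempotents B" "\<forall>a\<in>{n, m}. e \<otimes>\<^bsub>A\<^esub> a = a \<and> a \<otimes>\<^bsub>A\<^esub> e = a"
      using lu[unfolded local_units_def, rule_format, of "{n, m}"] n mA by auto
    have "n \<otimes>\<^bsub>A\<^esub> e \<otimes>\<^bsub>A\<^esub> m \<in> B \<and> m \<otimes>\<^bsub>A\<^esub> e \<otimes>\<^bsub>A\<^esub> n \<in> B"
      using m e(1) by (auto simp: is_dagger_def idempotents_def)
    with e(2) show ?thesis by auto
  qed
  have comm: "x \<otimes>\<^bsub>A\<^esub> y = y \<otimes>\<^bsub>A\<^esub> x" if "x \<in> B" "y \<in> B" for x y
    using B that by (auto simp: comm_subalgebra_def)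
  have c1: "(n \<otimes>\<^bsub>A\<^esub> l) \<otimes>\<^bsub>A\<^esub> (n \<otimes>\<^bsub>A\<^esub> k) = (n \<otimes>\<^bsub>A\<^esub> k) \<otimes>\<^bsub>A\<^esub> (n \<otimes>\<^bsub>A\<^esub> l)"
    and c2: "(k \<otimes>\<^bsub>A\<^esub> n) \<otimes>\<^bsub>A\<^esub> (l \<otimes>\<^bsub>A\<^esub> n) = (l \<otimes>\<^bsub>A\<^esub> n) \<otimes>\<^bsub>A\<^esub> (k \<otimes>\<^bsub>A\<^esub> n)"
    using prods[OF k] prods[OF l] by (auto intro: comm)
  have a1: "(n \<otimes>\<^bsub>A\<^esub> x) \<otimes>\<^bsub>A\<^esub> (n \<otimes>\<^bsub>A\<^esub> y) = n \<otimes>\<^bsub>A\<^esub> y"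
    if "n \<otimes>\<^bsub>A\<^esub> (x \<otimes>\<^bsub>A\<^esub> n) = n" "x \<in> carrier A" "y \<in> carrier A" for x y
  proof -
    have "(n \<otimes>\<^bsub>A\<^esub> x) \<otimes>\<^bsub>A\<^esub> (n \<otimes>\<^bsub>A\<^esub> y) = (n \<otimes>\<^bsub>A\<^esub> (x \<otimes>\<^bsub>A\<^esub> n)) \<otimes>\<^bsub>A\<^esub> y"
      using n that(2,3) by simp
    then show ?thesis by (simp only: that(1))
  qed
  have eq1: "n \<otimes>\<^bsub>A\<^esub> k = n \<otimes>\<^bsub>A\<^esub> l"
    using a1[OF e2(2) kl(2,1)] a1[OF e1(2) kl] c1 by argo
  have a2: "(x \<otimes>\<^bsub>A\<^esub> n) \<otimes>\<^bsub>A\<^esub> (y \<otimes>\<^bsub>A\<^esub> n) = x \<otimes>\<^bsub>A\<^esub> n"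
    if "n \<otimes>\<^bsub>A\<^esub> (y \<otimes>\<^bsub>A\<^esub> n) = n" "x \<in> carrier A" "y \<in> carrier A" for x y
    using n that by simp
  have eq2: "k \<otimes>\<^bsub>A\<^esub> n = l \<otimes>\<^bsub>A\<^esub> n"
    using a2[OF e2(2) kl] a2[OF e1(2) kl(2,1)] c2 by argo
  have "k = k \<otimes>\<^bsub>A\<^esub> (n \<otimes>\<^bsub>A\<^esub> l)" using e1(1) eq1 by simp
  also have "\<dots> = (k \<otimes>\<^bsub>A\<^esub> n) \<otimes>\<^bsub>A\<^esub> l" using n kl by simp
  also have "\<dots> = l \<otimes>\<^bsub>A\<^esub> (n \<otimes>\<^bsub>A\<^esub> l)" using n kl by (simp add: eq2)
  finally show ?thesis using e2(1) by simp
qed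

end

locale algebraic_pair = assoc_algebra R A for R (structure) and A (structure) +
  fixes B :: "'c set"
  assumes comm_subalgebra: "comm_subalgebra B"
    and torsion_free:
      "\<lbrakk>t \<in> carrier R; e \<in> idempotents B - {\<zero>\<^bsub>A\<^esub>}; t \<odot>\<^bsub>A\<^esub> e = \<zero>\<^bsub>A\<^esub>\<rbrakk> \<Longrightarrow> t = \<zero>\<^bsub>R\<^esub>"
    and local_units: "local_units (idempotents B)"
    and span_idempotents: "B = lin_span (idempotents B)"
    and span_normalisers: "carrier A = lin_span (normalisers B)"
    and ex_expectation: "\<exists>P. conditional_expectation B P \<and> faithful_expectation B P"

locale algebraic_diagonal_pair = algebraic_pair +
  assumes span_free_normalisers: "carrier A = lin_span (free_normalisers B)"

locale algebraic_cartan_pair = algebraic_pair +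
  assumes maximal: "maximal_comm_subalgebra B"

end

theory Submission
  imports Defs
begin

text \<open>
  Let \<open>P\<close> be a faithful conditional expectation and let \<open>a\<close> commute with every element of \<open>B\<close>.
  Subtracting \<open>P a\<close> leaves an element \<open>x\<close> that still commutes with \<open>B\<close> and satisfies \<open>P x = 0\<close>;
  it has to be shown that \<open>x = 0\<close>. By faithfulness this follows once \<open>P (n x) = 0\<close> for all \<open>n\<close>,
  and since \<open>A\<close> is spanned by free normalisers, \<open>n\<close> may be assumed to be one of these. If
  \<open>n \<in> B\<close>, then \<open>P (n x) = n (P x) = 0\<close>. Otherwise the range idempotent \<open>n n\<^sup>\<dagger>\<close> and the source
  idempotent \<open>n\<^sup>\<dagger> n\<close> lie in \<open>B\<close> and are orthogonal. As \<open>x\<close> commutes with the source idempotent,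
  multiplying \<open>n x\<close> by the range idempotent on the left and by the source idempotent on the right
  does not change it, so \<open>P (n x)\<close> is absorbed by both of them; in the commutative algebra \<open>B\<close>
  this forces \<open>P (n x) = 0\<close>. This is \<open>expectation_free_normaliser_mult_eq_zero\<close>.

  Hence \<open>a = P a \<in> B\<close> (\<open>centraliser_subset\<close>): the subalgebra \<open>B\<close> is its own centraliser, and in particular
  it is maximal among the commutative subalgebras.
\<close>

context assoc_algebra
begin

lemma null_mult:
  assumes "x \<in> carrier A"
  shows "\<zero>\<^bsub>A\<^esub> \<otimes>\<^bsub>A\<^esub> x = \<zero>\<^bsub>A\<^esub>"
proof -
  have "(\<zero> \<odot>\<^bsub>A\<^esub> \<zero>\<^bsub>A\<^esub>) \<otimes>\<^bsub>A\<^esub> x = \<zero> \<odot>\<^bsub>A\<^esub> (\<zero>\<^bsub>A\<^esub> \<otimes>\<^bsub>A\<^esub> x)"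
    using assms by (intro smult_mult_l) auto
  then show ?thesis using assms by (simp add: mult_closed)
qed

lemma mult_null:
  assumes "x \<in> carrier A"
  shows "x \<otimes>\<^bsub>A\<^esub> \<zero>\<^bsub>A\<^esub> = \<zero>\<^bsub>A\<^esub>"
proof -
  have "x \<otimes>\<^bsub>A\<^esub> (\<zero> \<odot>\<^bsub>A\<^esub> \<zero>\<^bsub>A\<^esub>) = \<zero> \<odot>\<^bsub>A\<^esub> (x \<otimes>\<^bsub>A\<^esub> \<zero>\<^bsub>A\<^esub>)"
    using assms by (intro smult_mult_r) auto
  then show ?thesis using assms by (simp add: mult_closed)
qed

lemma lin_span_least:
  assumes W: "submodule W R A" and SW: "S \<subseteq> W"
  shows "lin_span S \<subseteq> W"
proof -
  note W_props = submoduleE[OF W]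
  have zero: "\<zero>\<^bsub>A\<^esub> \<in> W"
  proof -
    obtain w where w: "w \<in> W" using W_props(2) by auto
    then have "\<zero> \<odot>\<^bsub>A\<^esub> w \<in> W" using W_props(4) by simp
    then show ?thesis using w W_props(1) by (simp add: subsetD)
  qed
  have "(\<Oplus>\<^bsub>A\<^esub>x\<in>F. c x \<odot>\<^bsub>A\<^esub> x) \<in> W"
    if "finite F" "F \<subseteq> S" "c \<in> F \<rightarrow> carrier R" for F c
    using that
  proof (induction F rule: finite_induct)
    case empty
    show ?case using zero by simp
  next
    case (insert x F)
    have term_W: "c y \<odot>\<^bsub>A\<^esub> y \<in> W" if "y \<in> insert x F" for y
      using insert.prems that SW by (intro W_props(4)) auto
    then have term_A: "c y \<odot>\<^bsub>A\<^esub> y \<in> carrier A" if "y \<in> insert x F" for y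
      using that W_props(1) by blast
    have "(\<Oplus>\<^bsub>A\<^esub>x\<in>insert x F. c x \<odot>\<^bsub>A\<^esub> x) = c x \<odot>\<^bsub>A\<^esub> x \<oplus>\<^bsub>A\<^esub> (\<Oplus>\<^bsub>A\<^esub>x\<in>F. c x \<odot>\<^bsub>A\<^esub> x)"
      using insert.hyps term_A by (intro M.finsum_insert) auto
    also have "\<dots> \<in> W"
      using insert term_W by (intro W_props(5)) auto
    finally show ?case .
  qed
  then show ?thesis by (auto simp: lin_span_def)
qed

lemma dagger_is_dagger:
  assumes B: "comm_subalgebra B" and lu: "local_units (idempotents B)"
    and n: "n \<in> normalisers B"
  shows "is_dagger B n (dagger B n)"
  unfolding dagger_def
proof (rule theI')
  have nA: "n \<in> carrier A" and ex: "\<exists>k. is_dagger B n k"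
    using n by (auto simp: normalisers_def)
  then show "\<exists>!k. is_dagger B n k"
    using is_dagger_unique[OF B lu nA] by blast
qed

text \<open>
  Since \<open>A\<close> need not be unital, the conditions \<open>n b k \<in> B\<close> and \<open>k b n \<in> B\<close> on a normaliser cannot be
  used with \<open>b = 1\<close>; an idempotent acting as a unit on \<open>n\<close> and \<open>k\<close> takes the place of \<open>1\<close>.
\<close>

lemma range_source_in_subalgebra:
  assumes lu: "local_units (idempotents B)"
    and n: "n \<in> carrier A" and k: "is_dagger B n k"
  shows "n \<otimes>\<^bsub>A\<^esub> k \<in> B" and "k \<otimes>\<^bsub>A\<^esub> n \<in> B"
proof -
  have kA: "k \<in> carrier A" using k by (simp add: is_dagger_def)
  obtain e where e: "e \<in> idempotents B" "\<forall>a\<in>{n, k}. e \<otimes>\<^bsub>A\<^esub> a = a \<and> a \<otimes>\<^bsub>A\<^esub> e = a"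
    using lu[unfolded local_units_def, rule_format, of "{n, k}"] n kA by auto
  have "n \<otimes>\<^bsub>A\<^esub> e \<otimes>\<^bsub>A\<^esub> k \<in> B" "k \<otimes>\<^bsub>A\<^esub> e \<otimes>\<^bsub>A\<^esub> n \<in> B"
    using k e(1) by (auto simp: is_dagger_def idempotents_def)
  with e(2) show "n \<otimes>\<^bsub>A\<^esub> k \<in> B" "k \<otimes>\<^bsub>A\<^esub> n \<in> B" by auto
qed

lemma expectation_left_mult:
  assumes lu: "local_units (idempotents B)" and BA: "B \<subseteq> carrier A"
    and P: "conditional_expectation B P"
    and b: "b \<in> B" and x: "x \<in> carrier A"
  shows "P (b \<otimes>\<^bsub>A\<^esub> x) = b \<otimes>\<^bsub>A\<^esub> P x"
proof -
  have Px: "P x \<in> carrier A" and bA: "b \<in> carrier A"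
    using P x b BA by (auto simp: conditional_expectation_def)
  \<comment> \<open>The bimodule law is two-sided, so the missing right factor is supplied by a local unit
    common to \<open>x\<close> and \<open>P x\<close>.\<close>
  obtain e where e: "e \<in> B" and ex: "x \<otimes>\<^bsub>A\<^esub> e = x" and eP: "P x \<otimes>\<^bsub>A\<^esub> e = P x"
    using lu[unfolded local_units_def, rule_format, of "{x, P x}"] x Px
    by (auto simp: idempotents_def)
  have "P (b \<otimes>\<^bsub>A\<^esub> x \<otimes>\<^bsub>A\<^esub> e) = b \<otimes>\<^bsub>A\<^esub> P x \<otimes>\<^bsub>A\<^esub> e"
    using P b e x by (auto simp: conditional_expectation_def)
  then show ?thesis
    using e BA bA x Px ex eP by (simp add: mult_assoc subsetD)
qed

text \<open>
  The kernel of an \<open>R\<close>-linear map, which is why \<open>P (n x) = 0\<close> needs checking only for \<open>n\<close> in a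
  spanning set.
\<close>

lemma left_annihilator_submodule:
  assumes BA: "B \<subseteq> carrier A" and P: "conditional_expectation B P" and x: "x \<in> carrier A"
  shows "submodule {y \<in> carrier A. P (y \<otimes>\<^bsub>A\<^esub> x) = \<zero>\<^bsub>A\<^esub>} R A" (is "submodule ?W R A")
proof -
  have add: "P (y \<oplus>\<^bsub>A\<^esub> z) = P y \<oplus>\<^bsub>A\<^esub> P z" if "y \<in> carrier A" "z \<in> carrier A" for y z
    using P that by (simp add: conditional_expectation_def)
  have smult: "P (t \<odot>\<^bsub>A\<^esub> y) = t \<odot>\<^bsub>A\<^esub> P y" if "t \<in> carrier R" "y \<in> carrier A" for t y
    using P that by (simp add: conditional_expectation_def)
  have smult_W: "t \<odot>\<^bsub>A\<^esub> y \<in> ?W" if "t \<in> carrier R" "y \<in> ?W" for t y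
    using that x by (simp add: smult_mult_l mult_closed smult)
  show ?thesis
  proof (rule submoduleI)
    have "P \<zero>\<^bsub>A\<^esub> \<in> carrier A"
      using P BA by (auto simp: conditional_expectation_def)
    then have "P \<zero>\<^bsub>A\<^esub> = \<zero>\<^bsub>A\<^esub>"
      using smult[of \<zero> "\<zero>\<^bsub>A\<^esub>"] by simp
    then show "\<zero>\<^bsub>A\<^esub> \<in> ?W" using x by (simp add: null_mult)
  next
    fix y assume y: "y \<in> ?W"
    then have "(\<ominus> \<one>) \<odot>\<^bsub>A\<^esub> y = \<ominus>\<^bsub>A\<^esub> y" by (simp add: smult_l_minus)
    then show "\<ominus>\<^bsub>A\<^esub> y \<in> ?W" using smult_W[OF _ y, of "\<ominus> \<one>"] by simp
  qed (use x smult_W in \<open>auto simp: mult_l_distr mult_closed add\<close>)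
qed

text \<open>
  The two idempotents \<open>r = n n\<^sup>\<dagger>\<close> and \<open>s = n\<^sup>\<dagger> n\<close> satisfy \<open>n x = r (n x) s\<close>, the right factor because
  \<open>n = n s\<close> and \<open>s\<close> can be moved past \<open>x\<close>. For \<open>n \<notin> B\<close>, freeness says \<open>s r = 0\<close>, and \<open>P\<close> carries
  the corner \<open>r A s\<close> into \<open>r B s = s r B = 0\<close>.
\<close>

lemma expectation_free_normaliser_mult_eq_zero:
  assumes B: "comm_subalgebra B" and lu: "local_units (idempotents B)"
    and P: "conditional_expectation B P"
    and n: "n \<in> free_normalisers B"
    and x: "x \<in> carrier A" and comm: "\<And>b. b \<in> B \<Longrightarrow> b \<otimes>\<^bsub>A\<^esub> x = x \<otimes>\<^bsub>A\<^esub> b"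
    and Px: "P x = \<zero>\<^bsub>A\<^esub>"
  shows "P (n \<otimes>\<^bsub>A\<^esub> x) = \<zero>\<^bsub>A\<^esub>"
proof -
  have BA: "B \<subseteq> carrier A"
    using B by (auto simp: comm_subalgebra_def dest: submoduleE(1))
  show ?thesis
  proof (cases "n \<in> B")
    case True
    then show ?thesis
      using expectation_left_mult[OF lu BA P True x] BA Px by (simp add: mult_null subsetD)
  next
    case False
    define k where "k = dagger B n"
    define r where "r = n \<otimes>\<^bsub>A\<^esub> k"
    define s where "s = k \<otimes>\<^bsub>A\<^esub> n"
    define c where "c = P (n \<otimes>\<^bsub>A\<^esub> x)"
    have nN: "n \<in> normalisers B" and orth: "s \<otimes>\<^bsub>A\<^esub> r = \<zero>\<^bsub>A\<^esub>"
      using n False by (auto simp: free_normalisers_def k_def r_def s_def)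
    have nA: "n \<in> carrier A" using nN by (simp add: normalisers_def)
    have k: "is_dagger B n k"
      unfolding k_def using B lu nN by (rule dagger_is_dagger)
    have kA: "k \<in> carrier A" and nkn: "n \<otimes>\<^bsub>A\<^esub> k \<otimes>\<^bsub>A\<^esub> n = n"
      using k by (auto simp: is_dagger_def)
    have rB: "r \<in> B" and sB: "s \<in> B"
      unfolding r_def s_def using lu nA k by (rule range_source_in_subalgebra)+
    have rA: "r \<in> carrier A" and sA: "s \<in> carrier A" using rB sB BA by auto
    have cB: "c \<in> B"
      unfolding c_def using P nA x by (auto simp: conditional_expectation_def mult_closed)
    then have cA: "c \<in> carrier A" using BA by auto
    have rn: "r \<otimes>\<^bsub>A\<^esub> n = n" using nkn by (simp add: r_def)
    have ns: "n \<otimes>\<^bsub>A\<^esub> s = n" using nkn nA kA by (simp add: s_def mult_assoc)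
    have "r \<otimes>\<^bsub>A\<^esub> (n \<otimes>\<^bsub>A\<^esub> x) \<otimes>\<^bsub>A\<^esub> s = (r \<otimes>\<^bsub>A\<^esub> n) \<otimes>\<^bsub>A\<^esub> (x \<otimes>\<^bsub>A\<^esub> s)"
      using rA nA x sA by (simp add: mult_assoc mult_closed)
    also have "\<dots> = n \<otimes>\<^bsub>A\<^esub> (s \<otimes>\<^bsub>A\<^esub> x)"
      using rn comm[OF sB] by simp
    also have "\<dots> = n \<otimes>\<^bsub>A\<^esub> x"
      using nA sA x ns by (simp add: mult_assoc[symmetric])
    finally have "c = P (r \<otimes>\<^bsub>A\<^esub> (n \<otimes>\<^bsub>A\<^esub> x) \<otimes>\<^bsub>A\<^esub> s)"
      by (simp add: c_def)
    also have "\<dots> = r \<otimes>\<^bsub>A\<^esub> c \<otimes>\<^bsub>A\<^esub> s"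
      unfolding c_def using P rB sB nA x
      by (simp add: conditional_expectation_def mult_closed)
    also have "\<dots> = s \<otimes>\<^bsub>A\<^esub> (r \<otimes>\<^bsub>A\<^esub> c)"
      using B rB cB sB by (simp add: comm_subalgebra_def)
    also have "\<dots> = (s \<otimes>\<^bsub>A\<^esub> r) \<otimes>\<^bsub>A\<^esub> c"
      using rA sA cA by (simp add: mult_assoc)
    also have "\<dots> = \<zero>\<^bsub>A\<^esub>"
      using orth cA by (simp add: null_mult)
    finally show ?thesis by (simp add: c_def)
  qed
qed

end

context algebraic_diagonal_pair
begin

text \<open>
  Faithfulness is a statement about elements of \<open>A\<close> that \<open>P\<close> annihilates after multiplication by
  normalisers, so it is applied to \<open>a - P a\<close>, the component of \<open>a\<close> in the kernel of \<open>P\<close>. This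
  difference inherits commutation with \<open>B\<close> because \<open>B\<close> is commutative.
\<close>

lemma centraliser_subset:
  assumes a: "a \<in> carrier A" and comm_a: "\<And>b. b \<in> B \<Longrightarrow> b \<otimes>\<^bsub>A\<^esub> a = a \<otimes>\<^bsub>A\<^esub> b"
  shows "a \<in> B"
proof -
  obtain P where P: "conditional_expectation B P" and faithful: "faithful_expectation B P"
    using ex_expectation by blast
  have BA: "B \<subseteq> carrier A"
    using comm_subalgebra by (auto simp: comm_subalgebra_def dest: submoduleE(1))
  have PB: "P a \<in> B" and PPa: "P (P a) = P a"
    using P a by (auto simp: conditional_expectation_def)
  then have PA: "P a \<in> carrier A" and mPB: "\<ominus>\<^bsub>A\<^esub> P a \<in> B"
    using BA comm_subalgebra by (auto simp: comm_subalgebra_def dest: submoduleE(3))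
  define x where "x = a \<oplus>\<^bsub>A\<^esub> \<ominus>\<^bsub>A\<^esub> P a"
  have x: "x \<in> carrier A" using a PA by (simp add: x_def)
  have "P x = P a \<oplus>\<^bsub>A\<^esub> P (\<ominus>\<^bsub>A\<^esub> P a)"
    unfolding x_def using P a PA by (simp add: conditional_expectation_def)
  also have "P (\<ominus>\<^bsub>A\<^esub> P a) = \<ominus>\<^bsub>A\<^esub> P a"
    using P mPB by (simp add: conditional_expectation_def)
  finally have Px: "P x = \<zero>\<^bsub>A\<^esub>" using PA by (simp add: M.r_neg)
  have comm_x: "b \<otimes>\<^bsub>A\<^esub> x = x \<otimes>\<^bsub>A\<^esub> b" if b: "b \<in> B" for b
  proof -
    have bA: "b \<in> carrier A" using b BA by auto
    have "b \<otimes>\<^bsub>A\<^esub> (\<ominus>\<^bsub>A\<^esub> P a) = (\<ominus>\<^bsub>A\<^esub> P a) \<otimes>\<^bsub>A\<^esub> b"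
      using comm_subalgebra b mPB by (simp add: comm_subalgebra_def)
    then show ?thesis
      using bA a PA comm_a[OF b] by (simp add: x_def mult_l_distr mult_r_distr)
  qed
  let ?W = "{y \<in> carrier A. P (y \<otimes>\<^bsub>A\<^esub> x) = \<zero>\<^bsub>A\<^esub>}"
  have "free_normalisers B \<subseteq> ?W"
    using expectation_free_normaliser_mult_eq_zero[OF comm_subalgebra local_units P _ x comm_x Px]
    by (auto simp: free_normalisers_def normalisers_def)
  then have "lin_span (free_normalisers B) \<subseteq> ?W"
    by (rule lin_span_least[OF left_annihilator_submodule[OF BA P x]])
  then have "carrier A \<subseteq> ?W"
    by (simp only: span_free_normalisers[symmetric])
  then have "P (n \<otimes>\<^bsub>A\<^esub> x) = \<zero>\<^bsub>A\<^esub>" if "n \<in> normalisers B" for n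
    using that by (auto simp: normalisers_def)
  then have "x = \<zero>\<^bsub>A\<^esub>"
    using faithful x by (auto simp: faithful_expectation_def)
  then have "a = P a"
    using a PA by (metis M.r_neg M.minus_equality M.minus_minus M.add.inv_closed M.a_comm x_def)
  with PB show ?thesis by simp
qed

lemma maximal_commutative: "maximal_comm_subalgebra B"
  unfolding maximal_comm_subalgebra_def
proof (intro conjI allI impI comm_subalgebra)
  fix C assume C: "comm_subalgebra C \<and> B \<subseteq> C"
  have CA: "C \<subseteq> carrier A"
    using C by (auto simp: comm_subalgebra_def dest: submoduleE(1))
  have "C \<subseteq> B"
  proof
    fix a assume a: "a \<in> C"
    show "a \<in> B"
    proof (rule centraliser_subset)
      show "a \<in> carrier A" using a CA by auto
      show "b \<otimes>\<^bsub>A\<^esub> a = a \<otimes>\<^bsub>A\<^esub> b" if "b \<in> B" for b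
        using C a that unfolding comm_subalgebra_def by blast
    qed
  qed
  with C show "C = B" by blast
qed

end

theorem lemma3p5:
  fixes R :: "('r, 'm) ring_scheme"
    and A :: "('r, 'a, 'n) module_scheme"
    and B :: "'a set"
  assumes "algebraic_diagonal_pair R A B"
  shows "algebraic_cartan_pair R A B"
proof -
  interpret algebraic_diagonal_pair R A B by (fact assms)
  show ?thesis
    by unfold_locales (rule maximal_commutative)
qed

end
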